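(* Let $\lambda\in\mathbb{R}$. If $S(u,v,t)$ is a smooth solution of the Hamilton-Jacobi equation $$\frac{\partial S}{\partial t}(u,v,t)=H\left(u-(1-\lambda)\frac{\partial S}{\partial v}(u,v,t),\ v+\lambda\frac{\partial S}{\partial u}(u,v,t)\right)$$ with initial condition $S(u,v,0)=0$, then the mapping $(p,q)\mapsto(P(t),Q(t))$ defined implicitly by $$P=p-\partial_vS\big(\lambda P+(1-\lambda)p,\ \lambda q+(1-\lambda)Q,\ t\big),\qquad Q=q+\partial_uS\big(\lambda P+(1-\lambda)p,\ \lambda q+(1-\lambda)Q,\ t\big)$$ is the exact flow of the Hamiltonian system $\dot p=-H_q(p,q)$, $\dot q=H_p(p,q)$; that is, $\dot P=-H_q(P,Q)$, $\dot Q=H_p(P,Q)$, with $P(0)=p$, $Q(0)=q$.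
   Context: $H=H(p,q)$ is a smooth real-valued Hamiltonian of $p,q\in\mathbb{R}^d$; $H_p,H_q$ denote the column vectors of partial derivatives of $H$ with respect to its first and second argument. The variables $u,v$ range over $\mathbb{R}^d$ and $\partial_uS,\partial_vS$ are the gradients of $S$ with respect to $u$ and $v$. The statement is local: $|t|$ is taken small enough that the implicit equations define a mapping $(p,q)\mapsto(P(t),Q(t))$ close to the identity (in value and in Jacobian), depending smoothly on $t$. *)

theory Defs
  imports "HOL-Analysis.Analysis"
begin

text \<open>
  \<open>C_on k f A\<close> is \<open>C\<^sup>k\<close> on \<open>A\<close>, for open \<open>A\<close>. The Frechet derivative has a different
  codomain at each order, so the recursion goes through the directional derivatives
  \<open>x \<mapsto> Df(x) v\<close> instead; in finite dimension these determine \<open>Df\<close>.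
\<close>

primrec C_on :: "nat \<Rightarrow> ('a::real_normed_vector \<Rightarrow> 'b::real_normed_vector) \<Rightarrow> 'a set \<Rightarrow> bool" where
  "C_on 0 f A \<longleftrightarrow> continuous_on A f"
| "C_on (Suc k) f A \<longleftrightarrow> (\<forall>x\<in>A. f differentiable (at x)) \<and>
     (\<forall>v. C_on k (\<lambda>x. frechet_derivative f (at x) v) A)"

definition smooth_on :: "('a::real_normed_vector \<Rightarrow> 'b::real_normed_vector) \<Rightarrow> 'a set \<Rightarrow> bool" where
  "smooth_on f A \<longleftrightarrow> (\<forall>k. C_on k f A)"

definition gradient :: "(real ^ 'n \<Rightarrow> real) \<Rightarrow> real ^ 'n \<Rightarrow> real ^ 'n" where
  "gradient f x = (\<chi> i. deriv (\<lambda>h. f (x + h *\<^sub>R axis i 1)) 0)"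

lemma gradient_eq:
  assumes "GDERIV f x :> D"
  shows "gradient f x = D"
proof -
  have "((\<lambda>h. f (x + h *\<^sub>R axis i 1)) has_real_derivative D $ i) (at 0)" for i
  proof -
    have "((\<lambda>h::real. x + h *\<^sub>R axis i 1) has_derivative (\<lambda>h. h *\<^sub>R axis i 1)) (at 0)"
      by (auto intro!: derivative_eq_intros)
    moreover have "(f has_derivative (\<lambda>h. h \<bullet> D)) (at (x + 0 *\<^sub>R axis i 1))"
      using assms by (simp add: gderiv_def)
    ultimately have "((\<lambda>h. f (x + h *\<^sub>R axis i 1)) has_derivative (\<lambda>h. (h *\<^sub>R axis i 1) \<bullet> D)) (at 0)"
      by (rule has_derivative_compose)
    then show ?thesis
      by (simp add: has_field_derivative_def inner_axis' mult.commute[of "D $ i"] mult_commute_abs)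
  qed
  then show ?thesis
    by (simp add: gradient_def vec_eq_iff DERIV_imp_deriv)
qed

definition hamilton_jacobi ::
    "real \<Rightarrow> (real ^ 'n \<Rightarrow> real ^ 'n \<Rightarrow> real) \<Rightarrow> ((real ^ 'n) \<times> (real ^ 'n) \<times> real) set \<Rightarrow>
     (real ^ 'n \<Rightarrow> real ^ 'n \<Rightarrow> real \<Rightarrow> real) \<Rightarrow> bool" where
  "hamilton_jacobi lam H D S \<longleftrightarrow>
     (\<forall>u v t. (u, v, t) \<in> D \<longrightarrow>
        ((\<lambda>s. S u v s) has_real_derivative
           H (u - (1 - lam) *\<^sub>R gradient (\<lambda>v'. S u v' t) v)
             (v + lam *\<^sub>R gradient (\<lambda>u'. S u' v t) u)) (at t))"

definition hamiltonian_flow ::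
    "(real ^ 'n \<Rightarrow> real ^ 'n \<Rightarrow> real) \<Rightarrow> ((real ^ 'n) \<times> (real ^ 'n)) set \<Rightarrow> real set \<Rightarrow>
     (real ^ 'n \<Rightarrow> real ^ 'n \<Rightarrow> real \<Rightarrow> real ^ 'n) \<Rightarrow>
     (real ^ 'n \<Rightarrow> real ^ 'n \<Rightarrow> real \<Rightarrow> real ^ 'n) \<Rightarrow> bool" where
  "hamiltonian_flow H N I P Q \<longleftrightarrow>
     (\<forall>p q. (p, q) \<in> N \<longrightarrow>
        P p q 0 = p \<and> Q p q 0 = q \<and>
        (\<forall>t\<in>I.
           ((\<lambda>s. P p q s) has_vector_derivative - gradient (\<lambda>y. H (P p q t) y) (Q p q t)) (at t) \<and>
           ((\<lambda>s. Q p q s) has_vector_derivative gradient (\<lambda>x. H x (Q p q t)) (P p q t)) (at t)))"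

end

theory Submission
  imports Defs
begin

text \<open>
  Write \<open>u = \<lambda> P + (1 - \<lambda>) p\<close> and \<open>v = \<lambda> q + (1 - \<lambda>) Q\<close>. The implicit equations give
  \<open>P = u - (1 - \<lambda>) S\<^sub>v\<close> and \<open>Q = v + \<lambda> S\<^sub>u\<close>, so the Hamilton-Jacobi equation reads
  \<open>S\<^sub>t = H(P, Q)\<close>. Differentiating it in \<open>u\<close> and \<open>v\<close> and using the symmetry of \<open>D\<^sup>2S\<close> yields
  \<open>D\<^sup>2S((- \<lambda> H\<^sub>q, (1 - \<lambda>) H\<^sub>p, 1), (a, b, 0)) = H\<^sub>p \<bullet> a + H\<^sub>q \<bullet> b\<close>. On the other hand,
  differentiating the implicit equations in \<open>t\<close> at fixed \<open>(p, q)\<close> gives a linear system for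
  \<open>(u', v')\<close>, of which \<open>(- \<lambda> H\<^sub>q, (1 - \<lambda>) H\<^sub>p)\<close> is a solution. Its matrix is nonsingular, because
  the derivative of \<open>(p, q) \<mapsto> (u, v)\<close> is a right inverse of it, so \<open>(u', v')\<close> equals this
  solution; then \<open>P' = - D\<^sub>t S\<^sub>v = - H\<^sub>q\<close> and \<open>Q' = D\<^sub>t S\<^sub>u = H\<^sub>p\<close>, with \<open>D\<^sub>t\<close> the derivative
  along the curve.
\<close>

text \<open>The mean value theorem is applied twice: along \<open>a\<close> to the increment of
  \<open>f\<close> in direction \<open>b\<close>, then along \<open>b\<close> to the directional
  derivative \<open>f' _ a\<close>. The second difference is unchanged when \<open>a\<close> and
  \<open>b\<close> are exchanged, and this yields the symmetry of second derivatives.\<close>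

lemma second_difference_mvt:
  fixes f :: "'a::real_normed_vector \<Rightarrow> real"
  assumes h: "h > 0"
    and inA: "\<And>s r. 0 \<le> s \<Longrightarrow> s \<le> h \<Longrightarrow> 0 \<le> r \<Longrightarrow> r \<le> h \<Longrightarrow> x + s *\<^sub>R a + r *\<^sub>R b \<in> A"
    and f': "\<And>y. y \<in> A \<Longrightarrow> (f has_derivative f' y) (at y)"
    and fa: "\<And>y. y \<in> A \<Longrightarrow> ((\<lambda>y. f' y a) has_derivative fa y) (at y)"
  obtains s r where "0 < s" "s < h" "0 < r" "r < h"
    "f (x + h *\<^sub>R a + h *\<^sub>R b) - f (x + h *\<^sub>R a) - f (x + h *\<^sub>R b) + f x
      = h\<^sup>2 * fa (x + s *\<^sub>R a + r *\<^sub>R b) b"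
proof -
  define g where "g s = f (x + s *\<^sub>R a + h *\<^sub>R b) - f (x + s *\<^sub>R a)" for s
  have f_line: "((\<lambda>s. f (x + s *\<^sub>R a + r *\<^sub>R b)) has_real_derivative f' (x + s *\<^sub>R a + r *\<^sub>R b) a) (at s)"
    if "0 \<le> s" "s \<le> h" "0 \<le> r" "r \<le> h" for s r
  proof -
    have "((\<lambda>s. x + s *\<^sub>R a + r *\<^sub>R b) has_derivative (\<lambda>d. d *\<^sub>R a)) (at s)"
      by (auto intro!: derivative_eq_intros)
    from has_derivative_compose[OF this f'[OF inA[OF that]]]
    show ?thesis
      using linear_cmul[OF has_derivative_linear[OF f'[OF inA[OF that]]]]
      by (simp add: has_field_derivative_def mult_commute_abs)
  qed
  have dg: "(g has_real_derivative (f' (x + s *\<^sub>R a + h *\<^sub>R b) a - f' (x + s *\<^sub>R a) a)) (at s)"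
    if "0 \<le> s" "s \<le> h" for s
    unfolding g_def
    using DERIV_diff[OF f_line[of s h] f_line[of s 0]] that h by simp
  obtain s where s: "0 < s" "s < h"
    and gs: "g h - g 0 = h * (f' (x + s *\<^sub>R a + h *\<^sub>R b) a - f' (x + s *\<^sub>R a) a)"
    using MVT2[OF h dg] by auto
  define k where "k r = f' (x + s *\<^sub>R a + r *\<^sub>R b) a" for r
  have dk: "(k has_real_derivative fa (x + s *\<^sub>R a + r *\<^sub>R b) b) (at r)"
    if "0 \<le> r" "r \<le> h" for r
  proof -
    have sr: "x + s *\<^sub>R a + r *\<^sub>R b \<in> A" using inA s that by simp
    have "((\<lambda>r. x + s *\<^sub>R a + r *\<^sub>R b) has_derivative (\<lambda>d. d *\<^sub>R b)) (at r)"
      by (auto intro!: derivative_eq_intros)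
    from has_derivative_compose[OF this fa[OF sr]]
    show ?thesis
      using linear_cmul[OF has_derivative_linear[OF fa[OF sr]]]
      by (simp add: has_field_derivative_def mult_commute_abs k_def[abs_def])
  qed
  obtain r where r: "0 < r" "r < h" and kr: "k h - k 0 = h * fa (x + s *\<^sub>R a + r *\<^sub>R b) b"
    using MVT2[OF h dk] by auto
  have "f (x + h *\<^sub>R a + h *\<^sub>R b) - f (x + h *\<^sub>R a) - f (x + h *\<^sub>R b) + f x = g h - g 0"
    by (simp add: g_def)
  also have "\<dots> = h * (k h - k 0)" by (simp add: gs k_def)
  also have "\<dots> = h\<^sup>2 * fa (x + s *\<^sub>R a + r *\<^sub>R b) b" by (simp add: kr power2_eq_square)
  finally show ?thesis using that s r by blast
qed

text \<open>Schwarz's theorem. The mean value form of the second difference, taken in both orders,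
  equates a value of \<open>fa _ b\<close> near \<open>x\<close> with a value of
  \<open>fb _ a\<close> near \<open>x\<close>; continuity carries the equality to
  \<open>x\<close>.\<close>

lemma second_derivative_symmetric:
  fixes f :: "'a::real_normed_vector \<Rightarrow> real"
  assumes A: "open A" "x \<in> A"
    and f': "\<And>y. y \<in> A \<Longrightarrow> (f has_derivative f' y) (at y)"
    and fa: "\<And>y. y \<in> A \<Longrightarrow> ((\<lambda>y. f' y a) has_derivative fa y) (at y)"
    and fb: "\<And>y. y \<in> A \<Longrightarrow> ((\<lambda>y. f' y b) has_derivative fb y) (at y)"
    and ca: "continuous_on A (\<lambda>y. fa y b)"
    and cb: "continuous_on A (\<lambda>y. fb y a)"
  shows "fa x b = fb x a"
proof (rule ccontr)
  assume neq: "fa x b \<noteq> fb x a"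
  \<comment> \<open>Half the gap, so no number lies within \<open>e\<close> of both second
    derivatives at \<open>x\<close>.\<close>
  define e where "e = \<bar>fa x b - fb x a\<bar> / 2"
  have e: "e > 0" using neq by (simp add: e_def)
  have near: "\<exists>d>0. \<forall>y. dist y x < d \<longrightarrow> dist (g y) (g x) < e"
    if "continuous_on A g" for g :: "'a \<Rightarrow> real"
    using that A e by (auto simp: continuous_on_eq_continuous_at continuous_at_eps_delta)
  obtain d1 where d1: "d1 > 0" "\<And>y. dist y x < d1 \<Longrightarrow> \<bar>fa y b - fa x b\<bar> < e"
    using near[OF ca] by (auto simp: dist_real_def)
  obtain d2 where d2: "d2 > 0" "\<And>y. dist y x < d2 \<Longrightarrow> \<bar>fb y a - fb x a\<bar> < e"
    using near[OF cb] by (auto simp: dist_real_def)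
  obtain d3 where d3: "d3 > 0" "\<And>y. dist y x < d3 \<Longrightarrow> y \<in> A"
    using A by (auto simp: open_dist)
  define d where "d = min d1 (min d2 d3)"
  \<comment> \<open>This keeps the parallelogram with sides \<open>h *\<^sub>R a\<close> and
    \<open>h *\<^sub>R b\<close> in the ball of radius \<open>d\<close>; the summand 1 covers
    \<open>a = b = 0\<close>.\<close>
  define h where "h = d / (norm a + norm b + 1)"
  have pos: "norm a + norm b + 1 > 0" by (simp add: add_nonneg_pos)
  have d: "d > 0" using d1 d2 d3 by (simp add: d_def)
  have h: "h > 0" using d pos by (simp add: h_def)
  have close: "dist (x + s *\<^sub>R a + r *\<^sub>R b) x < d"
    if "0 \<le> s" "s \<le> h" "0 \<le> r" "r \<le> h" for s r
  proof -
    have "dist (x + s *\<^sub>R a + r *\<^sub>R b) x = norm (s *\<^sub>R a + r *\<^sub>R b)" by (simp add: dist_norm)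
    also have "\<dots> \<le> s * norm a + r * norm b"
      using norm_triangle_ineq[of "s *\<^sub>R a" "r *\<^sub>R b"] that by simp
    also have "\<dots> \<le> h * norm a + h * norm b"
      using that by (intro add_mono mult_right_mono) auto
    also have "\<dots> < h * (norm a + norm b + 1)" using h by (simp add: algebra_simps)
    also have "\<dots> = d" using pos by (simp add: h_def)
    finally show ?thesis .
  qed
  have inA: "x + s *\<^sub>R a + r *\<^sub>R b \<in> A"
    if "0 \<le> s" "s \<le> h" "0 \<le> r" "r \<le> h" for s r
    using close[OF that] d3(2) by (simp add: d_def)
  have inA': "x + r *\<^sub>R b + s *\<^sub>R a \<in> A"
    if "0 \<le> r" "r \<le> h" "0 \<le> s" "s \<le> h" for s r
    using inA[OF that(3,4,1,2)] by (simp add: algebra_simps)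
  obtain s r where sr: "0 < s" "s < h" "0 < r" "r < h"
    "f (x + h *\<^sub>R a + h *\<^sub>R b) - f (x + h *\<^sub>R a) - f (x + h *\<^sub>R b) + f x
      = h\<^sup>2 * fa (x + s *\<^sub>R a + r *\<^sub>R b) b"
    by (rule second_difference_mvt[OF h inA f' fa])
  obtain r' s' where sr': "0 < r'" "r' < h" "0 < s'" "s' < h"
    "f (x + h *\<^sub>R b + h *\<^sub>R a) - f (x + h *\<^sub>R b) - f (x + h *\<^sub>R a) + f x
      = h\<^sup>2 * fb (x + r' *\<^sub>R b + s' *\<^sub>R a) a"
    by (rule second_difference_mvt[OF h inA' f' fb])
  have swap: "x + h *\<^sub>R b + h *\<^sub>R a = x + h *\<^sub>R a + h *\<^sub>R b"
    "x + r' *\<^sub>R b + s' *\<^sub>R a = x + s' *\<^sub>R a + r' *\<^sub>R b" by simp_all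
  have "h\<^sup>2 * fa (x + s *\<^sub>R a + r *\<^sub>R b) b = h\<^sup>2 * fb (x + s' *\<^sub>R a + r' *\<^sub>R b) a"
    using sr(5) sr'(5) unfolding swap by linarith
  then have "fa (x + s *\<^sub>R a + r *\<^sub>R b) b = fb (x + s' *\<^sub>R a + r' *\<^sub>R b) a" using h by simp
  moreover have "\<bar>fa (x + s *\<^sub>R a + r *\<^sub>R b) b - fa x b\<bar> < e"
    using close[of s r] sr by (intro d1(2)) (simp add: d_def)
  moreover have "\<bar>fb (x + s' *\<^sub>R a + r' *\<^sub>R b) a - fb x a\<bar> < e"
    using close[of s' r'] sr' by (intro d2(2)) (simp add: d_def)
  ultimately show False using e_def by (simp add: abs_if split: if_splits)
qed

text \<open>Packages the directional recursion of \<open>C_on\<close> as a derivative and a Hessian.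
  In \<open>f'' x v w\<close> the vector \<open>v\<close> is frozen before the second
  differentiation and \<open>w\<close> is its direction, so linearity is immediate in
  \<open>w\<close>.\<close>

lemma C_on_2_second_derivative:
  fixes f :: "'a::real_normed_vector \<Rightarrow> real"
  assumes "C_on 2 f A" "open A"
  obtains f' f'' where
    "\<And>x. x \<in> A \<Longrightarrow> (f has_derivative f' x) (at x)"
    "\<And>x v. x \<in> A \<Longrightarrow> ((\<lambda>x. f' x v) has_derivative f'' x v) (at x)"
    "\<And>x v w. x \<in> A \<Longrightarrow> f'' x v w = f'' x w v"
proof -
  define f' where "f' x = frechet_derivative f (at x)" for x
  define f'' where "f'' x v = frechet_derivative (\<lambda>x. f' x v) (at x)" for x v
  have D1: "(f has_derivative f' x) (at x)" if "x \<in> A" for x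
    using assms(1) that by (simp add: numeral_2_eq_2 f'_def frechet_derivative_works)
  have D2: "((\<lambda>x. f' x v) has_derivative f'' x v) (at x)" if "x \<in> A" for x v
    using assms(1) that
    by (simp add: numeral_2_eq_2 f'_def[abs_def] f''_def frechet_derivative_works)
  have cont: "continuous_on A (\<lambda>x. f'' x v w)" for v w
    using assms(1) by (simp add: numeral_2_eq_2 f'_def[abs_def] f''_def)
  have "f'' x v w = f'' x w v" if "x \<in> A" for x v w
    by (rule second_derivative_symmetric[OF assms(2) that D1 D2 D2 cont cont])
  with D1 D2 show ?thesis by (rule that)
qed

section \<open>Gradients and vector-valued derivatives\<close>

lemma smooth_on_imp_differentiable:
  assumes "smooth_on f A" "x \<in> A"
  shows "f differentiable (at x)"
proof -
  have "C_on (Suc 0) f A" using assms(1) unfolding smooth_on_def by blast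
  then show ?thesis using assms(2) by simp
qed

text \<open>The coordinatewise \<open>gradient\<close> is the Riesz vector
  \<open>adjoint g' 1\<close> of the derivative.\<close>

lemma gradient_inner:
  assumes "(g has_derivative g') (at x)"
  shows "gradient g x \<bullet> a = g' a"
proof -
  have lin: "linear g'" using assms by (rule has_derivative_linear)
  have "GDERIV g x :> adjoint g' 1"
    using assms adjoint_works[OF lin, of _ 1] by (simp add: gderiv_def)
  then show ?thesis
    using adjoint_works[OF lin, of a 1] by (simp add: gradient_eq inner_commute)
qed

lemma gradient_compose_inner:
  assumes "(j has_derivative j') (at x)" "(f has_derivative f') (at (j x))"
  shows "gradient (\<lambda>x. f (j x)) x \<bullet> a = f' (j' a)"
  by (rule gradient_inner[OF has_derivative_compose[OF assms]])

text \<open>Serves to differentiate a gradient field known only by its inner products. The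
  derivative is assembled over \<open>Basis\<close>; uniqueness of derivatives extends the formula
  to every \<open>c\<close>.\<close>

lemma has_derivative_inner_components:
  fixes G :: "'a::real_normed_vector \<Rightarrow> 'b::euclidean_space"
  assumes "open A" "z \<in> A"
    and eq: "\<And>y c. y \<in> A \<Longrightarrow> G y \<bullet> c = g y c"
    and g': "\<And>c. ((\<lambda>y. g y c) has_derivative g' c) (at z)"
  obtains G' where "(G has_derivative G') (at z)" "\<And>w c. G' w \<bullet> c = g' c w"
proof -
  have comp: "((\<lambda>y. G y \<bullet> c) has_derivative g' c) (at z)" for c
    by (rule has_derivative_transform_within_open[OF g' assms(1,2)]) (simp add: eq)
  have G': "(G has_derivative (\<lambda>w. \<Sum>b\<in>Basis. g' b w *\<^sub>R b)) (at z)"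
    using comp by (subst has_derivative_componentwise_within) simp
  moreover have "(\<Sum>b\<in>Basis. g' b w *\<^sub>R b) \<bullet> c = g' c w" for w c
    using has_derivative_unique[OF has_derivative_inner_left[OF G', of c] comp[of c]] by metis
  ultimately show ?thesis by (rule that)
qed

theorem theorem2p2:
  fixes H :: "real ^ 'n \<Rightarrow> real ^ 'n \<Rightarrow> real"
    and S :: "real ^ 'n \<Rightarrow> real ^ 'n \<Rightarrow> real \<Rightarrow> real"
    and D :: "((real ^ 'n) \<times> (real ^ 'n) \<times> real) set"
    and N :: "((real ^ 'n) \<times> (real ^ 'n)) set"
    and P Q :: "real ^ 'n \<Rightarrow> real ^ 'n \<Rightarrow> real \<Rightarrow> real ^ 'n"
    and lam \<epsilon> :: real
  assumes H_smooth: "smooth_on (\<lambda>(p, q). H p q) UNIV"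
    and D_open: "open D"
    and S_smooth: "smooth_on (\<lambda>(u, v, t). S u v t) D"
    and S_HJ: "hamilton_jacobi lam H D S"
    and S_init: "\<And>u v. (u, v, 0) \<in> D \<Longrightarrow> S u v 0 = 0"
    and N_open: "open N"
    and \<epsilon>_pos: "\<epsilon> > 0"
    and PQ_in_D: "\<And>p q t. (p, q) \<in> N \<Longrightarrow> \<bar>t\<bar> < \<epsilon> \<Longrightarrow>
        (lam *\<^sub>R P p q t + (1 - lam) *\<^sub>R p, lam *\<^sub>R q + (1 - lam) *\<^sub>R Q p q t, t) \<in> D"
    and P_eq: "\<And>p q t. (p, q) \<in> N \<Longrightarrow> \<bar>t\<bar> < \<epsilon> \<Longrightarrow>
        P p q t = p - gradient (\<lambda>v. S (lam *\<^sub>R P p q t + (1 - lam) *\<^sub>R p) v t)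
                        (lam *\<^sub>R q + (1 - lam) *\<^sub>R Q p q t)"
    and Q_eq: "\<And>p q t. (p, q) \<in> N \<Longrightarrow> \<bar>t\<bar> < \<epsilon> \<Longrightarrow>
        Q p q t = q + gradient (\<lambda>u. S u (lam *\<^sub>R q + (1 - lam) *\<^sub>R Q p q t) t)
                        (lam *\<^sub>R P p q t + (1 - lam) *\<^sub>R p)"
    and PQ_differentiable: "\<And>t. \<bar>t\<bar> < \<epsilon> \<Longrightarrow>
        (\<lambda>(p, q). (P p q t, Q p q t)) differentiable_on N"
    and P_smooth_t: "\<And>p q. (p, q) \<in> N \<Longrightarrow> smooth_on (\<lambda>t. P p q t) {-\<epsilon><..<\<epsilon>}"
    and Q_smooth_t: "\<And>p q. (p, q) \<in> N \<Longrightarrow> smooth_on (\<lambda>t. Q p q t) {-\<epsilon><..<\<epsilon>}"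
  shows "hamiltonian_flow H N {-\<epsilon><..<\<epsilon>} P Q"
proof -

  \<comment> \<open>Derivatives of S on the space of (u, v, t)\<close>
  define F where "F = (\<lambda>(u, v, t). S u v t)"
  have "C_on 2 F D" using S_smooth by (simp add: F_def smooth_on_def)
  then obtain dF T where dF: "\<And>z. z \<in> D \<Longrightarrow> (F has_derivative dF z) (at z)"
    and T: "\<And>z x. z \<in> D \<Longrightarrow> ((\<lambda>z. dF z x) has_derivative T z x) (at z)"
    and T_sym: "\<And>z x y. z \<in> D \<Longrightarrow> T z x y = T z y x"
    using C_on_2_second_derivative[OF _ D_open] by metis
  have T_linear: "linear (T z x)" if "z \<in> D" for z x
    using T[OF that] by (rule has_derivative_linear)
  \<comment> \<open>The partial gradients are handled in weak form: testing with a vector evaluates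
    \<open>dF\<close> on a fixed argument, whose derivative in \<open>z\<close> is
    \<open>T\<close>.\<close>
  define Su where "Su = (\<lambda>(u, v, t). gradient (\<lambda>u. S u v t) u)"
  define Sv where "Sv = (\<lambda>(u, v, t). gradient (\<lambda>v. S u v t) v)"
  have Su_inner: "Su z \<bullet> a = dF z (a, 0, 0)" if "z \<in> D" for z a
  proof (cases z)
    case (fields u v t)
    have "((\<lambda>u. (u, v, t)) has_derivative (\<lambda>a. (a, 0, 0))) (at u)"
      by (auto intro!: derivative_eq_intros simp: zero_prod_def)
    from gradient_compose_inner[OF this, of F "dF z" a] dF[OF that] show ?thesis
      by (simp add: fields F_def Su_def)
  qed
  have Sv_inner: "Sv z \<bullet> b = dF z (0, b, 0)" if "z \<in> D" for z b
  proof (cases z)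
    case (fields u v t)
    have "((\<lambda>v. (u, v, t)) has_derivative (\<lambda>b. (0, b, 0))) (at v)"
      by (auto intro!: derivative_eq_intros simp: zero_prod_def)
    from gradient_compose_inner[OF this, of F "dF z" b] dF[OF that] show ?thesis
      by (simp add: fields F_def Sv_def)
  qed

  \<comment> \<open>The Hamilton-Jacobi equation and its spatial derivative\<close>
  have dF_time: "dF z (0, 0, 1) =
      H (fst z - (1 - lam) *\<^sub>R Sv z) (fst (snd z) + lam *\<^sub>R Su z)" if "z \<in> D" for z
  proof (cases z)
    case (fields u v t)
    have "((\<lambda>s. (u, v, s)) has_derivative (\<lambda>d. (0, 0, d))) (at t)"
      by (auto intro!: derivative_eq_intros simp: zero_prod_def)
    from has_derivative_compose[OF this, of F "dF z"] dF[OF that]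
    have "((\<lambda>s. S u v s) has_derivative (\<lambda>d. dF z (0, 0, d))) (at t)"
      by (simp add: fields F_def)
    moreover have "((\<lambda>s. S u v s) has_derivative
        (*) (H (u - (1 - lam) *\<^sub>R Sv z) (v + lam *\<^sub>R Su z))) (at t)"
      using S_HJ that unfolding hamilton_jacobi_def has_field_derivative_def
      by (simp add: fields Sv_def Su_def)
    ultimately have "(\<lambda>d. dF z (0, 0, d)) = (*) (H (u - (1 - lam) *\<^sub>R Sv z) (v + lam *\<^sub>R Su z))"
      by (rule has_derivative_unique)
    from fun_cong[OF this, of 1] show ?thesis by (simp add: fields)
  qed

  text \<open>The Hamilton-Jacobi equation differentiated in the direction \<open>(a, b, 0)\<close>.\<close>
  have HJ': "T z (- lam *\<^sub>R gradient (\<lambda>y. H x y) y, (1 - lam) *\<^sub>R gradient (\<lambda>x. H x y) x, 1) (a, b, 0)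
      = gradient (\<lambda>x. H x y) x \<bullet> a + gradient (\<lambda>y. H x y) y \<bullet> b"
    if z: "z \<in> D" and x: "x = fst z - (1 - lam) *\<^sub>R Sv z" and y: "y = fst (snd z) + lam *\<^sub>R Su z"
    for z x y a b
  proof -
    let ?Hp = "gradient (\<lambda>x. H x y) x" and ?Hq = "gradient (\<lambda>y. H x y) y"
    define w where "w = (a, b, 0::real)"
    obtain H' where H': "((\<lambda>(p, q). H p q) has_derivative H') (at (x, y))"
      using smooth_on_imp_differentiable[OF H_smooth] by (auto simp: differentiable_def)
    have "((\<lambda>x. (x, y)) has_derivative (\<lambda>c. (c, 0))) (at x)"
      by (auto intro!: derivative_eq_intros)
    from gradient_compose_inner[OF this H'] have Hp: "?Hp \<bullet> c = H' (c, 0)" for c by simp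
    have "((\<lambda>y. (x, y)) has_derivative (\<lambda>c. (0, c))) (at y)"
      by (auto intro!: derivative_eq_intros)
    from gradient_compose_inner[OF this H'] have Hq: "?Hq \<bullet> c = H' (0, c)" for c by simp
    have H'_eq: "H' (c, d) = ?Hp \<bullet> c + ?Hq \<bullet> d" for c d
      using linear_add[OF has_derivative_linear[OF H'], of "(c, 0)" "(0, d)"] by (simp add: Hp Hq)
    obtain Su' where Su': "(Su has_derivative Su') (at z)" "\<And>w c. Su' w \<bullet> c = T z (c, 0, 0) w"
      using has_derivative_inner_components[OF D_open z Su_inner T[OF z]] by metis
    obtain Sv' where Sv': "(Sv has_derivative Sv') (at z)" "\<And>w c. Sv' w \<bullet> c = T z (0, c, 0) w"
      using has_derivative_inner_components[OF D_open z Sv_inner T[OF z]] by metis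
    have "((\<lambda>z. (fst z - (1 - lam) *\<^sub>R Sv z, fst (snd z) + lam *\<^sub>R Su z)) has_derivative
        (\<lambda>w. (fst w - (1 - lam) *\<^sub>R Sv' w, fst (snd w) + lam *\<^sub>R Su' w))) (at z)"
      by (auto intro!: derivative_eq_intros Su'(1) Sv'(1))
    from has_derivative_compose[OF this, of "\<lambda>(p, q). H p q" H'] H'
    have "((\<lambda>z. H (fst z - (1 - lam) *\<^sub>R Sv z) (fst (snd z) + lam *\<^sub>R Su z)) has_derivative
        (\<lambda>w. H' (fst w - (1 - lam) *\<^sub>R Sv' w, fst (snd w) + lam *\<^sub>R Su' w))) (at z)"
      by (simp add: x y)
    \<comment> \<open>The Hamilton-Jacobi equation holds on all of the open set \<open>D\<close>, so
      the chain-rule derivative of its right-hand side is also that of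
      \<open>dF _ (0, 0, 1)\<close>.\<close>
    then have "((\<lambda>z. dF z (0, 0, 1)) has_derivative
        (\<lambda>w. H' (fst w - (1 - lam) *\<^sub>R Sv' w, fst (snd w) + lam *\<^sub>R Su' w))) (at z)"
      by (rule has_derivative_transform_within_open[OF _ D_open z]) (simp add: dF_time)
    from fun_cong[OF has_derivative_unique[OF T[OF z] this], of w]
    have "T z (0, 0, 1) w = ?Hp \<bullet> (a - (1 - lam) *\<^sub>R Sv' w) + ?Hq \<bullet> (b + lam *\<^sub>R Su' w)"
      by (simp add: w_def H'_eq)
    also have "\<dots> = ?Hp \<bullet> a + ?Hq \<bullet> b - (1 - lam) * T z (0, ?Hp, 0) w + lam * T z (?Hq, 0, 0) w"
      using Sv'(2)[of w ?Hp] Su'(2)[of w ?Hq]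
      by (simp add: inner_diff_right inner_add_right inner_commute)
    finally have time: "T z (0, 0, 1) w
      = ?Hp \<bullet> a + ?Hq \<bullet> b - (1 - lam) * T z (0, ?Hp, 0) w + lam * T z (?Hq, 0, 0) w" .
    \<comment> \<open>Symmetry moves the combined vector into the last slot of \<open>T\<close>,
      where linearity is available. Its weights cancel the two second-derivative terms in
      \<open>time\<close>.\<close>
    have "T z (- lam *\<^sub>R ?Hq, (1 - lam) *\<^sub>R ?Hp, 1) w
      = T z w ((- lam) *\<^sub>R (?Hq, 0, 0) + (1 - lam) *\<^sub>R (0, ?Hp, 0) + (0, 0, 1))"
      by (simp add: T_sym[OF z, of w])
    also have "\<dots> = - lam * T z w (?Hq, 0, 0) + (1 - lam) * T z w (0, ?Hp, 0) + T z w (0, 0, 1)"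
      by (simp only: linear_add[OF T_linear[OF z]] linear_cmul[OF T_linear[OF z]] real_scaleR_def)
    also have "\<dots> = ?Hp \<bullet> a + ?Hq \<bullet> b"
      by (simp add: T_sym[OF z, of w] time)
    finally show ?thesis by (simp add: w_def)
  qed

  show ?thesis
    unfolding hamiltonian_flow_def
  proof (intro allI impI conjI ballI)
    fix p q assume pq: "(p, q) \<in> N"
    \<comment> \<open>The point (u, v, t) at which the implicit equations evaluate the gradients of
      S. It is differentiated both in \<open>t\<close> and in the initial data.\<close>
    define Z where "Z p q t =
      (lam *\<^sub>R P p q t + (1 - lam) *\<^sub>R p, lam *\<^sub>R q + (1 - lam) *\<^sub>R Q p q t, t)" for p q t
    have Z_D: "Z p q t \<in> D" if "(p, q) \<in> N" "\<bar>t\<bar> < \<epsilon>" for p q t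
      using PQ_in_D[OF that] by (simp add: Z_def)
    have P_Z: "P p q t = p - Sv (Z p q t)" if "(p, q) \<in> N" "\<bar>t\<bar> < \<epsilon>" for p q t
      using P_eq[OF that] by (simp add: Z_def Sv_def)
    have Q_Z: "Q p q t = q + Su (Z p q t)" if "(p, q) \<in> N" "\<bar>t\<bar> < \<epsilon>" for p q t
      using Q_eq[OF that] by (simp add: Z_def Su_def)

    \<comment> \<open>Initial values\<close>
    have "dF (Z p q 0) (a, b, 0) = 0" for a b
    proof -
      let ?z = "Z p q 0"
      have z: "?z \<in> D" using Z_D[OF pq] \<epsilon>_pos by simp
      have line: "((\<lambda>s. ?z + s *\<^sub>R (a, b, 0)) has_derivative (\<lambda>d. d *\<^sub>R (a, b, 0))) (at (0::real))"
        by (auto intro!: derivative_eq_intros)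
      have "((\<lambda>s. F (?z + s *\<^sub>R (a, b, 0))) has_derivative (\<lambda>d. dF ?z (d *\<^sub>R (a, b, 0)))) (at (0::real))"
        using has_derivative_compose[OF line, of F "dF ?z"] dF[OF z]
        by (simp add: zero_prod_def[symmetric])
      \<comment> \<open>As \<open>D\<close> is open, a short segment in direction (a, b, 0) stays in
        \<open>D\<close> at time 0, where S vanishes. So both gradients vanish there.\<close>
      moreover have "((\<lambda>s. F (?z + s *\<^sub>R (a, b, 0))) has_derivative (\<lambda>d. 0)) (at (0::real))"
      proof (rule has_derivative_transform_within_open[of "\<lambda>s. 0::real"])
        show "open ((\<lambda>s::real. ?z + s *\<^sub>R (a, b, 0)) -` D)"
          by (intro open_vimage D_open continuous_intros)
        show "0 \<in> (\<lambda>s::real. ?z + s *\<^sub>R (a, b, 0)) -` D"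
          using z by (simp add: zero_prod_def[symmetric])
        show "0 = F (?z + s *\<^sub>R (a, b, 0))" if "s \<in> (\<lambda>s::real. ?z + s *\<^sub>R (a, b, 0)) -` D" for s
          using that S_init by (simp add: Z_def F_def)
      qed simp
      ultimately have "(\<lambda>d. dF ?z (d *\<^sub>R (a, b, 0))) = (\<lambda>d. 0)" by (rule has_derivative_unique)
      from fun_cong[OF this, of 1] show ?thesis by simp
    qed
    then have "Sv (Z p q 0) \<bullet> b = 0" "Su (Z p q 0) \<bullet> a = 0" for a b
      using Sv_inner Su_inner Z_D[OF pq] \<epsilon>_pos by simp_all
    then have "Sv (Z p q 0) = 0" "Su (Z p q 0) = 0" by (metis inner_eq_zero_iff)+
    then show "P p q 0 = p" "Q p q 0 = q" using P_Z[OF pq] Q_Z[OF pq] \<epsilon>_pos by simp_all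

    \<comment> \<open>Velocity in time at fixed initial data\<close>
    fix t assume "t \<in> {-\<epsilon><..<\<epsilon>}"
    then have t: "\<bar>t\<bar> < \<epsilon>" by auto
    define z where "z = Z p q t"
    have z: "z \<in> D" using Z_D[OF pq t] by (simp add: z_def)
    let ?Hp = "gradient (\<lambda>x. H x (Q p q t)) (P p q t)" and ?Hq = "gradient (\<lambda>y. H (P p q t) y) (Q p q t)"

    \<comment> \<open>The velocity of \<open>Z p q\<close> predicted by Hamilton's equations: -H_q
      and H_p inserted for P' and Q' in u' = lam P' and v' = (1 - lam) Q'. The actual velocity is
      \<open>z'\<close> below.\<close>
    define \<zeta> where "\<zeta> = (- lam *\<^sub>R ?Hq, (1 - lam) *\<^sub>R ?Hp, 1::real)"
    have T_\<zeta>: "T z (a, b, 0) \<zeta> = ?Hp \<bullet> a + ?Hq \<bullet> b" for a b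
    proof -
      have Sz: "Sv z = p - P p q t" "Su z = Q p q t - q"
        using P_Z[OF pq t] Q_Z[OF pq t] by (simp_all flip: z_def)
      have uv: "fst z = lam *\<^sub>R P p q t + (1 - lam) *\<^sub>R p"
        "fst (snd z) = lam *\<^sub>R q + (1 - lam) *\<^sub>R Q p q t"
        by (simp_all add: z_def Z_def)
      \<comment> \<open>By the implicit equations the arguments of H in the Hamilton-Jacobi equation
        are P and Q, so \<open>HJ'\<close> applies at that point.\<close>
      have "P p q t = fst z - (1 - lam) *\<^sub>R Sv z" "Q p q t = fst (snd z) + lam *\<^sub>R Su z"
        unfolding Sz uv by (simp_all add: algebra_simps)
      from HJ'[OF z this] show ?thesis by (simp add: \<zeta>_def T_sym[OF z, of "(a, b, 0)"])
    qed

    obtain P' where P': "((\<lambda>s. P p q s) has_vector_derivative P') (at t)"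
      using smooth_on_imp_differentiable[OF P_smooth_t[OF pq] \<open>t \<in> _\<close>]
      by (auto simp: vector_derivative_works)
    obtain Q' where Q': "((\<lambda>s. Q p q s) has_vector_derivative Q') (at t)"
      using smooth_on_imp_differentiable[OF Q_smooth_t[OF pq] \<open>t \<in> _\<close>]
      by (auto simp: vector_derivative_works)
    define z' where "z' = (lam *\<^sub>R P', (1 - lam) *\<^sub>R Q', 1::real)"
    have Z': "((\<lambda>s. Z p q s) has_derivative (\<lambda>d. d *\<^sub>R z')) (at t)"
      using P' Q' unfolding Z_def has_vector_derivative_def z'_def
      by (auto intro!: derivative_eq_intros simp: fun_eq_iff scaleR_Pair algebra_simps)
    have dF_Z: "((\<lambda>s. dF (Z p q s) x) has_derivative (\<lambda>d. d * T z x z')) (at t)" for x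
      using has_derivative_compose[OF Z', of "\<lambda>z. dF z x" "T z x"] T[OF z] linear_cmul[OF T_linear[OF z]]
      by (simp add: z_def)
    have P'_inner: "P' \<bullet> b = - T z (0, b, 0) z'" for b
    proof -
      have "((\<lambda>s. p \<bullet> b - dF (Z p q s) (0, b, 0)) has_derivative (\<lambda>d. - (d * T z (0, b, 0) z'))) (at t)"
        by (auto intro!: derivative_eq_intros dF_Z)
      then have "((\<lambda>s. P p q s \<bullet> b) has_derivative (\<lambda>d. - (d * T z (0, b, 0) z'))) (at t)"
        by (rule has_derivative_transform_within_open[OF _ open_greaterThanLessThan \<open>t \<in> _\<close>])
          (auto simp: P_Z[OF pq] inner_diff_left Sv_inner[OF Z_D[OF pq]])
      moreover have "((\<lambda>s. P p q s \<bullet> b) has_derivative (\<lambda>d. (d *\<^sub>R P') \<bullet> b)) (at t)"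
        using P' unfolding has_vector_derivative_def by (rule has_derivative_inner_left)
      ultimately show ?thesis using has_derivative_unique by (metis mult_1 scaleR_one)
    qed
    have Q'_inner: "Q' \<bullet> a = T z (a, 0, 0) z'" for a
    proof -
      have "((\<lambda>s. q \<bullet> a + dF (Z p q s) (a, 0, 0)) has_derivative (\<lambda>d. d * T z (a, 0, 0) z')) (at t)"
        by (auto intro!: derivative_eq_intros dF_Z)
      then have "((\<lambda>s. Q p q s \<bullet> a) has_derivative (\<lambda>d. d * T z (a, 0, 0) z')) (at t)"
        by (rule has_derivative_transform_within_open[OF _ open_greaterThanLessThan \<open>t \<in> _\<close>])
          (auto simp: Q_Z[OF pq] inner_add_left Su_inner[OF Z_D[OF pq]])
      moreover have "((\<lambda>s. Q p q s \<bullet> a) has_derivative (\<lambda>d. (d *\<^sub>R Q') \<bullet> a)) (at t)"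
        using Q' unfolding has_vector_derivative_def by (rule has_derivative_inner_left)
      ultimately show ?thesis using has_derivative_unique by (metis mult_1 scaleR_one)
    qed

    \<comment> \<open>Derivative with respect to the initial data\<close>
    have "(\<lambda>x. (P (fst x) (snd x) t, Q (fst x) (snd x) t)) differentiable (at (p, q))"
      using PQ_differentiable[OF t] pq N_open
      by (simp add: differentiable_on_eq_differentiable_at case_prod_beta')
    then obtain R where R: "((\<lambda>x. (P (fst x) (snd x) t, Q (fst x) (snd x) t)) has_derivative R) (at (p, q))"
      by (auto simp: differentiable_def)
    have DP: "((\<lambda>x. P (fst x) (snd x) t) has_derivative (\<lambda>d. fst (R d))) (at (p, q))"
      using has_derivative_fst[OF R] by simp
    have DQ: "((\<lambda>x. Q (fst x) (snd x) t) has_derivative (\<lambda>d. snd (R d))) (at (p, q))"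
      using has_derivative_snd[OF R] by simp
    \<comment> \<open>The derivative of (p, q) \<mapsto> (u, v) at fixed t.\<close>
    define L where "L d = (lam *\<^sub>R fst (R d) + (1 - lam) *\<^sub>R fst d, lam *\<^sub>R snd d + (1 - lam) *\<^sub>R snd (R d))" for d
    have DZ: "((\<lambda>x. Z (fst x) (snd x) t) has_derivative (\<lambda>d. (fst (L d), snd (L d), 0))) (at (p, q))"
      unfolding Z_def L_def by (auto intro!: derivative_eq_intros DP DQ)
    have dF_DZ: "((\<lambda>x. dF (Z (fst x) (snd x) t) y) has_derivative
        (\<lambda>d. T z y (fst (L d), snd (L d), 0))) (at (p, q))" for y
      using has_derivative_compose[OF DZ, of "\<lambda>z. dF z y" "T z y"] T[OF z] by (simp add: z_def)
    have R_linear: "linear R" using R by (rule has_derivative_linear)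
    have L_linear: "linear L"
      by (rule linearI)
        (simp_all add: L_def linear_add[OF R_linear] linear_cmul[OF R_linear] algebra_simps)
    have DP_inner: "fst (R d) \<bullet> b = fst d \<bullet> b - T z (0, b, 0) (fst (L d), snd (L d), 0)" for d b
    proof -
      have "((\<lambda>x. fst x \<bullet> b - dF (Z (fst x) (snd x) t) (0, b, 0)) has_derivative
          (\<lambda>d. fst d \<bullet> b - T z (0, b, 0) (fst (L d), snd (L d), 0))) (at (p, q))"
        by (auto intro!: derivative_eq_intros dF_DZ)
      then have "((\<lambda>x. P (fst x) (snd x) t \<bullet> b) has_derivative
          (\<lambda>d. fst d \<bullet> b - T z (0, b, 0) (fst (L d), snd (L d), 0))) (at (p, q))"
        by (rule has_derivative_transform_within_open[OF _ N_open pq])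
          (use t in \<open>auto simp: P_Z inner_diff_left Sv_inner[OF Z_D]\<close>)
      from has_derivative_unique[OF this has_derivative_inner_left[OF DP]] show ?thesis by metis
    qed
    have DQ_inner: "snd (R d) \<bullet> a = snd d \<bullet> a + T z (a, 0, 0) (fst (L d), snd (L d), 0)" for d a
    proof -
      have "((\<lambda>x. snd x \<bullet> a + dF (Z (fst x) (snd x) t) (a, 0, 0)) has_derivative
          (\<lambda>d. snd d \<bullet> a + T z (a, 0, 0) (fst (L d), snd (L d), 0))) (at (p, q))"
        by (auto intro!: derivative_eq_intros dF_DZ)
      then have "((\<lambda>x. Q (fst x) (snd x) t \<bullet> a) has_derivative
          (\<lambda>d. snd d \<bullet> a + T z (a, 0, 0) (fst (L d), snd (L d), 0))) (at (p, q))"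
        by (rule has_derivative_transform_within_open[OF _ N_open pq])
          (use t in \<open>auto simp: Q_Z inner_add_left Su_inner[OF Z_D]\<close>)
      from has_derivative_unique[OF this has_derivative_inner_left[OF DQ]] show ?thesis by metis
    qed

    \<comment> \<open>Inserting the differentiated implicit equations eliminates \<open>R d\<close>,
      so \<open>d\<close> is expressed through \<open>L d\<close> alone.\<close>
    have fst_L: "fst (L d) \<bullet> b = fst d \<bullet> b - lam * T z (0, b, 0) (fst (L d), snd (L d), 0)" for d b
    proof -
      have "fst (L d) \<bullet> b = lam * (fst (R d) \<bullet> b) + (1 - lam) * (fst d \<bullet> b)"
        by (simp add: L_def inner_add_left)
      then show ?thesis unfolding DP_inner by (simp add: algebra_simps)
    qed
    have snd_L: "snd (L d) \<bullet> a = snd d \<bullet> a + (1 - lam) * T z (a, 0, 0) (fst (L d), snd (L d), 0)" for d a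
    proof -
      have "snd (L d) \<bullet> a = lam * (snd d \<bullet> a) + (1 - lam) * (snd (R d) \<bullet> a)"
        by (simp add: L_def inner_add_left)
      then show ?thesis unfolding DQ_inner by (simp add: algebra_simps)
    qed
    text \<open>So \<open>L\<close> is a right inverse of the Jacobian of
      \<open>(u, v) \<mapsto> (u + \<lambda> S\<^sub>v, v - (1 - \<lambda>) S\<^sub>u)\<close>, which is therefore nonsingular.\<close>
    have kernel: "\<mu> = 0 \<and> \<nu> = 0"
      if "\<And>b. \<mu> \<bullet> b = - lam * T z (0, b, 0) (\<mu>, \<nu>, 0)"
        and "\<And>a. \<nu> \<bullet> a = (1 - lam) * T z (a, 0, 0) (\<mu>, \<nu>, 0)" for \<mu> \<nu>
    proof -
      have zero: "T z x (0, 0, 0) = 0" for x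
        using linear_0[OF T_linear[OF z]] by (simp add: zero_prod_def)
      have "d = 0" if "L d = 0" for d
      proof -
        have "fst d \<bullet> b = 0" "snd d \<bullet> b = 0" for b
          using fst_L[of d b] snd_L[of d b] that by (simp_all add: zero)
        then show ?thesis by (metis inner_eq_zero_iff prod_eq_iff fst_zero snd_zero)
      qed
      \<comment> \<open>In finite dimension the injective \<open>L\<close> is surjective, so
        (\<open>\<mu>\<close>, \<open>\<nu>\<close>) is some \<open>L d\<close>; comparing
        \<open>fst_L\<close> and \<open>snd_L\<close> with the kernel equations gives
        \<open>d = 0\<close>.\<close>
      then have "inj L" using L_linear by (simp add: linear_injective_0)
      then have "surj L" using linear_injective_imp_surjective[OF L_linear] by blast
      then obtain d where d: "L d = (\<mu>, \<nu>)" by (metis surjD)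
      have "fst d \<bullet> b = 0" "snd d \<bullet> b = 0" for b
        using fst_L[of d b] snd_L[of d b] that[of b] by (simp_all add: d)
      then have "d = 0" by (metis inner_eq_zero_iff prod_eq_iff fst_zero snd_zero)
      then show ?thesis using d linear_0[OF L_linear] by (simp add: zero_prod_def)
    qed

    \<comment> \<open>Comparison of the actual and the predicted velocity\<close>
    define \<mu> where "\<mu> = lam *\<^sub>R P' + lam *\<^sub>R ?Hq"
    define \<nu> where "\<nu> = (1 - lam) *\<^sub>R Q' - (1 - lam) *\<^sub>R ?Hp"
    \<comment> \<open>Both time components are 1, so the discrepancy is purely spatial, and by
      linearity it solves the homogeneous system in \<open>kernel\<close>.\<close>
    have "z' = \<zeta> + (\<mu>, \<nu>, 0)" by (simp add: z'_def \<zeta>_def \<mu>_def \<nu>_def)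
    then have T_z': "T z (a, b, 0) z' = ?Hp \<bullet> a + ?Hq \<bullet> b + T z (a, b, 0) (\<mu>, \<nu>, 0)" for a b
      by (simp add: linear_add[OF T_linear[OF z]] T_\<zeta>)
    have "\<mu> \<bullet> b = - lam * T z (0, b, 0) (\<mu>, \<nu>, 0)" for b
    proof -
      have "\<mu> \<bullet> b = lam * (P' \<bullet> b + ?Hq \<bullet> b)"
        by (simp add: \<mu>_def inner_add_left distrib_left)
      then show ?thesis by (simp add: P'_inner T_z')
    qed
    moreover have "\<nu> \<bullet> a = (1 - lam) * T z (a, 0, 0) (\<mu>, \<nu>, 0)" for a
    proof -
      have "\<nu> \<bullet> a = (1 - lam) * (Q' \<bullet> a - ?Hp \<bullet> a)"
        by (simp add: \<nu>_def inner_diff_left right_diff_distrib)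
      then show ?thesis by (simp add: Q'_inner T_z')
    qed
    ultimately have "\<mu> = 0" "\<nu> = 0" using kernel by blast+
    then have z'_eq: "z' = \<zeta>" using \<open>z' = \<zeta> + (\<mu>, \<nu>, 0)\<close> by (simp add: zero_prod_def[symmetric])
    \<comment> \<open>Read off from the differentiated implicit equations, since
      \<open>\<mu> = 0\<close> says nothing about \<open>P'\<close> when \<open>lam = 0\<close>, and
      \<open>\<nu> = 0\<close> nothing about \<open>Q'\<close> when \<open>lam = 1\<close>.\<close>
    have "P' \<bullet> b = (- ?Hq) \<bullet> b" "Q' \<bullet> b = ?Hp \<bullet> b" for b
      by (simp_all add: P'_inner Q'_inner z'_eq T_\<zeta>)
    then have "P' = - ?Hq" "Q' = ?Hp" by (metis vector_eq_rdot)+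
    then show "((\<lambda>s. P p q s) has_vector_derivative - ?Hq) (at t)"
      "((\<lambda>s. Q p q s) has_vector_derivative ?Hp) (at t)"
      using P' Q' by simp_all
  qed
qed

end
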